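(* There is an absolute constant $c>0$ such that, for all sufficiently large integers $k$, $$\log A(k)\ge c\,k^{1/3}.$$
   Context: A north-east lattice path is a finite path in $\mathbb{Z}^2$ starting at the origin, each of whose steps (moves) is $(1,0)$ or $(0,1)$. A path with $n$ moves has $n+1$ visited vertices (including the origin). For an integer $k\ge 2$, $A(k)$ denotes the maximum number of moves in a north-east lattice path whose visited vertices contain no $k$ collinear points, i.e. such that no line in the plane contains $k$ of the visited vertices. Here $\log$ is the natural logarithm. *)

theory Defs
  imports "HOL-Analysis.Analysis"
begin

text \<open>A path with \<open>n\<close> moves is given by its vertices \<open>p 0, \<dots>, p n\<close>; the values of
  \<open>p\<close> beyond \<open>n\<close> are irrelevant.\<close>

definition ne_path :: "nat \<Rightarrow> (nat \<Rightarrow> int \<times> int) \<Rightarrow> bool" where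
  "ne_path n p \<longleftrightarrow> p 0 = (0, 0) \<and> (\<forall>i<n. p (Suc i) - p i \<in> {(1, 0), (0, 1)})"

definition visited :: "nat \<Rightarrow> (nat \<Rightarrow> int \<times> int) \<Rightarrow> (int \<times> int) set" where
  "visited n p = p ` {..n}"

definition to_plane :: "int \<times> int \<Rightarrow> real \<times> real" where
  "to_plane v = (of_int (fst v), of_int (snd v))"

definition has_k_collinear :: "nat \<Rightarrow> (int \<times> int) set \<Rightarrow> bool" where
  "has_k_collinear k V \<longleftrightarrow> (\<exists>S. S \<subseteq> V \<and> card S = k \<and> collinear (to_plane ` S))"

text \<open>Meaningful for \<open>k \<ge> 2\<close>.  The set is then nonempty (it contains 0), and it is finite by a
  theorem of Gerver and Ramsey, so that \<open>Max\<close> is the genuine maximum.\<close>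

definition max_moves :: "nat \<Rightarrow> nat" where
  "max_moves k = Max {n. \<exists>p. ne_path n p \<and> \<not> has_k_collinear k (visited n p)}"

end

(* Lower bound.  In the coordinates (x + y, y) a path is the graph of a function f with increments
   0 or 1.  Let n = 2^m, attach to every dyadic block of {0..<n} an independent uniform random number in
   [0, 1), and let the slope at a step be the average of the m + 1 numbers of the blocks containing it;
   f is the integer part of the resulting height.  If the path meets a line at abscissa a, then the
   number of a fresh dyadic block inside [a, b) makes the conditional probability of meeting it again
   at b at most 12 (m + 1) / (b - a).  Summing over b gives a factor 12 (m + 1)^2 for each further
   point, so a first moment estimate for the k-subsets with k = 4 (m + 1), combined with a union bound
   over the slopes, produces a path with n moves and no 96 (m + 1)^3 collinear vertices.

   Finiteness of the set in the definition of max_moves (Gerver and Ramsey).  By Koenig's lemma it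
   suffices to refute an infinite path without k collinear points.  Such a path eventually stays on one
   side of every rational slope through the origin, so a mediant search traps it between Farey
   neighbours p/q < p'/q' with q + q' arbitrarily large.  If q' is large, then q f(i) - p i is an integer
   between 0 and i / q', and the pigeonhole principle gives k points on a line; similarly for q. *)
theory Submission
  imports Defs
begin

subsection \<open>Every infinite path has many collinear points\<close>

text \<open>In the coordinates \<open>(x + y, y)\<close> the hypothesis describes a line of slope
  \<open>a / b\<close>; in the original coordinates its direction is
  \<open>(b - a, a)\<close>.\<close>

lemma collinear_to_plane:
  assumes "\<And>x. x \<in> S \<Longrightarrow> b * snd x - a * (fst x + snd x) = t" "b > 0"
  shows "collinear (to_plane ` S)"
proof -
  have "\<exists>c. to_plane x - to_plane y = c *\<^sub>R (of_int (b - a), of_int a)" if "x \<in> S" "y \<in> S" for x y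
  proof -
    obtain x1 x2 y1 y2 where xy: "x = (x1, x2)" "y = (y1, y2)" by fastforce
    have "b * (x2 - y2) = a * ((x1 + x2) - (y1 + y2))"
      using assms(1)[OF that(1)] assms(1)[OF that(2)] xy by (simp add: algebra_simps)
    then have "real_of_int (b * (x2 - y2)) = real_of_int (a * ((x1 + x2) - (y1 + y2)))" by (rule arg_cong)
    then have e: "of_int b * (of_int x2 - of_int y2) = (of_int a :: real) * ((of_int x1 + of_int x2) - (of_int y1 + of_int y2))"
      by simp
    show ?thesis
      using e assms(2) unfolding xy to_plane_def
      by (intro exI[of _ "((of_int x1 + of_int x2) - (of_int y1 + of_int y2)) / of_int b"])
        (simp add: field_simps)
  qed
  then show ?thesis unfolding collinear_def by blast
qed

lemma ne_path_sum:
  assumes "ne_path n p" "i \<le> n"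
  shows "fst (p i) + snd (p i) = int i"
  using assms(2)
proof (induction i)
  case (Suc i)
  then have "p (Suc i) - p i \<in> {(1, 0), (0, 1)}" using assms(1) unfolding ne_path_def by auto
  then have "fst (p (Suc i)) + snd (p (Suc i)) = fst (p i) + snd (p i) + 1"
    by (cases "p i"; cases "p (Suc i)") auto
  with Suc show ?case by simp
qed (use assms(1) in \<open>simp add: ne_path_def\<close>)

text \<open>Koenig's lemma for binary words: a prefix shared by infinitely many sequences can be
  extended by one bit that infinitely many of them still share.\<close>

lemma konig_bool:
  fixes s :: "nat \<Rightarrow> nat \<Rightarrow> bool"
  obtains d where "\<And>L. \<exists>n\<ge>L. \<forall>i<L. s n i = d i"
proof -
  define Q where "Q L w \<longleftrightarrow> infinite {n. \<forall>i<L. s n i = w i}" for L :: nat and w :: "nat \<Rightarrow> bool"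
  have "\<exists>F. \<forall>L. Q L (F L) \<and> (\<forall>i<L. F (Suc L) i = F L i)"
  proof (rule dependent_nat_choice)
    show "\<exists>w. Q 0 w" unfolding Q_def by simp
    fix w L assume "Q L w"
    then have inf: "infinite {n. \<forall>i<L. s n i = w i}" (is "infinite ?A") unfolding Q_def .
    obtain x where "infinite {n \<in> ?A. s n L = x}"
    proof (cases "finite {n \<in> ?A. s n L = True}")
      case True
      have "?A \<subseteq> {n \<in> ?A. s n L = True} \<union> {n \<in> ?A. s n L = False}" by blast
      then have "infinite {n \<in> ?A. s n L = False}" using inf True by (meson finite_UnI finite_subset)
      then show ?thesis by (rule that)
    qed (rule that)
    moreover have "{n \<in> ?A. s n L = x} = {n. \<forall>i<Suc L. s n i = (w(L := x)) i}"
      by (auto simp: less_Suc_eq)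
    ultimately have "Q (Suc L) (w(L := x))" unfolding Q_def by simp
    then show "\<exists>v. Q (Suc L) v \<and> (\<forall>i<L. v i = w i)" by (intro exI[of _ "w(L := x)"]) simp
  qed
  then obtain F where F: "\<And>L. Q L (F L)" "\<And>L i. i < L \<Longrightarrow> F (Suc L) i = F L i" by blast
  have st: "i < L \<Longrightarrow> F L i = F (Suc i) i" for i L
    by (induction L) (auto simp: F(2) less_Suc_eq)
  show ?thesis
  proof (rule that[of "\<lambda>i. F (Suc i) i"])
    fix L
    obtain n where "n \<ge> L" "n \<in> {n. \<forall>i<L. s n i = F L i}"
      using F(1)[of L] unfolding Q_def infinite_nat_iff_unbounded_le by blast
    then have "\<forall>i<L. s n i = F (Suc i) i" using st[of _ L] by simp
    with \<open>n \<ge> L\<close> show "\<exists>n\<ge>L. \<forall>i<L. s n i = F (Suc i) i" by blast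
  qed
qed

text \<open>In the coordinates \<open>(x + y, y)\<close> an infinite path is the graph of a function \<open>f\<close> as below.\<close>

locale ne_sequence =
  fixes f :: "nat \<Rightarrow> int" and k :: nat
  assumes f0: "f 0 = 0"
    and step: "\<And>i. f (Suc i) - f i \<in> {0, 1}"
    and few: "\<And>a b t. b > 0 \<Longrightarrow> finite {i. b * f i - a * int i = t} \<and> card {i. b * f i - a * int i = t} < k"
begin

text \<open>The steps of \<open>b * f i - a * i\<close> are bounded by \<open>a + b\<close>, so a change of sign would bring it into
  \<open>[-(a + b), a + b]\<close>, which happens only finitely often.\<close>

lemma eventually_one_side:
  assumes "a \<ge> 0" "b > 0"
  shows "(\<forall>\<^sub>F i in sequentially. b * f i \<le> a * int i) \<or> (\<forall>\<^sub>F i in sequentially. a * int i \<le> b * f i)"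
proof -
  define g where "g i = b * f i - a * int i" for i
  have "{i. \<bar>g i\<bar> \<le> a + b} = (\<Union>t\<in>{-(a + b)..a + b}. {i. b * f i - a * int i = t})"
    unfolding g_def by auto
  then have "finite {i. \<bar>g i\<bar> \<le> a + b}" using few[OF assms(2)] by simp
  then obtain N where N: "\<And>i. \<bar>g i\<bar> \<le> a + b \<Longrightarrow> i < N"
    unfolding finite_nat_set_iff_bounded by blast
  have big: "i \<ge> N \<Longrightarrow> \<bar>g i\<bar> > a + b" for i using N[of i] by linarith
  have "f (Suc i) = f i \<or> f (Suc i) = f i + 1" for i using step[of i] by auto
  then have "g (Suc i) = g i - a \<or> g (Suc i) = g i + b - a" for i
    unfolding g_def by (cases "f (Suc i) = f i") (force simp: algebra_simps)+
  then have st: "\<bar>g (Suc i) - g i\<bar> \<le> a + b" for i using assms by (smt (verit))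
  show ?thesis
  proof (cases "g N > 0")
    case True
    have "g i > 0" if "i \<ge> N" for i
      using that
    proof (induction rule: dec_induct)
      case (step i)
      with big[of i] st[of i] show ?case by linarith
    qed (fact True)
    then show ?thesis unfolding g_def eventually_sequentially by (intro disjI2 exI[of _ N]) force
  next
    case False
    have "g i \<le> 0" if "i \<ge> N" for i
      using that
    proof (induction rule: dec_induct)
      case (step i)
      with big[of i] st[of i] show ?case by linarith
    qed (use False in simp)
    then show ?thesis unfolding g_def eventually_sequentially by (intro disjI1 exI[of _ N]) force
  qed
qed

lemma f_bounds: "0 \<le> f i" "f i \<le> int i"
proof -
  have "0 \<le> f i \<and> f i \<le> int i"
  proof (induction i)
    case (Suc i)
    then show ?case using step[of i] by auto
  qed (simp add: f0)
  then show "0 \<le> f i" "f i \<le> int i" by auto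
qed

text \<open>Mediant search starting from 0/1 and 1/1. The path is eventually on one side of the
  mediant, which replaces the endpoint on the other side of the path. The determinant stays 1, and
  the sum of the denominators grows because both are positive.\<close>

lemma farey_neighbours:
  "\<exists>p q p' q'. 0 \<le> p \<and> 0 < q \<and> 0 \<le> p' \<and> 0 < q' \<and> p' * q - p * q' = 1 \<and> q + q' \<ge> int t + 2 \<and>
    (\<forall>\<^sub>F i in sequentially. p * int i \<le> q * f i \<and> q' * f i \<le> p' * int i)"
proof (induction t)
  case 0
  show ?case
    by (intro exI[of _ 0] exI[of _ 1]) (use f_bounds in \<open>auto intro: always_eventually\<close>)
next
  case (Suc t)
  then obtain p q p' q' where *: "0 \<le> p" "0 < q" "0 \<le> p'" "0 < q'" "p' * q - p * q' = 1" "q + q' \<ge> int t + 2"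
    "\<forall>\<^sub>F i in sequentially. p * int i \<le> q * f i \<and> q' * f i \<le> p' * int i" by blast
  have det: "(p + p') * q - p * (q + q') = 1" "p' * (q + q') - (p + p') * q' = 1"
    using *(5) by (simp_all add: algebra_simps)
  from eventually_one_side[of "p + p'" "q + q'"] * consider
    "\<forall>\<^sub>F i in sequentially. (q + q') * f i \<le> (p + p') * int i" |
    "\<forall>\<^sub>F i in sequentially. (p + p') * int i \<le> (q + q') * f i" by fastforce
  then show ?case
  proof cases
    case 1
    with *(7) have "\<forall>\<^sub>F i in sequentially. p * int i \<le> q * f i \<and> (q + q') * f i \<le> (p + p') * int i"
      by eventually_elim auto
    with * det show ?thesis
      by (intro exI[of _ p] exI[of _ q] exI[of _ "p + p'"] exI[of _ "q + q'"]) simp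
  next
    case 2
    with *(7) have "\<forall>\<^sub>F i in sequentially. (p + p') * int i \<le> (q + q') * f i \<and> q' * f i \<le> p' * int i"
      by eventually_elim auto
    with * det show ?thesis
      by (intro exI[of _ "p + p'"] exI[of _ "q + q'"] exI[of _ p'] exI[of _ q']) simp
  qed
qed

text \<open>The values \<open>c * (b * f i - a * int i)\<close> for \<open>N \<le> i < 2 * N\<close> are integers in an interval of length
  \<open>2 * N / q\<close>, so by pigeonhole one of them is taken more than \<open>k\<close> times.\<close>

lemma not_eventually_thin:
  assumes "b > 0" "\<bar>c\<bar> = 1" "q \<ge> 4 * int k + 4"
    and ev: "\<forall>\<^sub>F i in sequentially. 0 \<le> c * (b * f i - a * int i) \<and> q * (c * (b * f i - a * int i)) \<le> int i"
  shows False
proof -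
  define g where "g i = c * (b * f i - a * int i)" for i
  obtain N0 where N0: "\<And>i. i \<ge> N0 \<Longrightarrow> 0 \<le> g i \<and> q * g i \<le> int i"
    using ev unfolding eventually_sequentially g_def by blast
  \<comment> \<open>The final count gives \<open>N \<le> 2 * k\<close>, so any \<open>N\<close>
    above both \<open>N0\<close> and \<open>2 * k\<close> yields a contradiction.\<close>
  define N where "N = N0 + 2 * k + 2"
  have q: "q > 0" using assms by linarith
  have img: "g ` {N..<2 * N} \<subseteq> {0..2 * int N div q}"
  proof
    fix y assume "y \<in> g ` {N..<2 * N}"
    then obtain i where i: "y = g i" "N \<le> i" "i < 2 * N" by auto
    then have "0 \<le> g i" "q * g i \<le> 2 * int N" using N0[of i] unfolding N_def by auto
    then show "y \<in> {0..2 * int N div q}" using q i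
      by (metis atLeastAtMost_iff less_irrefl nonzero_mult_div_cancel_left zdiv_mono1)
  qed
  have fib: "card {i \<in> {N..<2 * N}. g i = y} \<le> k" for y
  proof -
    have cc: "c * c = 1" using assms(2) by (metis abs_mult_self_eq mult.right_neutral)
    then have "{i \<in> {N..<2 * N}. g i = y} \<subseteq> {i. b * f i - a * int i = c * y}"
      unfolding g_def by (auto simp flip: mult.assoc)
    then show ?thesis using few[OF assms(1), of a "c * y"] card_mono
      by (metis (no_types, lifting) le_trans less_imp_le_nat)
  qed
  have "N = card (\<Union>y\<in>{0..2 * int N div q}. {i \<in> {N..<2 * N}. g i = y})"
  proof -
    have "(\<Union>y\<in>{0..2 * int N div q}. {i \<in> {N..<2 * N}. g i = y}) = {N..<2 * N}" using img by blast
    then show ?thesis by simp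
  qed
  also have "\<dots> \<le> (\<Sum>y\<in>{0..2 * int N div q}. card {i \<in> {N..<2 * N}. g i = y})"
    by (rule card_UN_le) simp
  also have "\<dots> \<le> (\<Sum>y\<in>{0..2 * int N div q}. k)" by (intro sum_mono fib)
  also have "\<dots> = card {0..2 * int N div q} * k" by simp
  finally have "int N \<le> int (card {0..2 * int N div q} * k)" by (rule of_nat_mono)
  moreover have "2 * int N div q \<ge> 0" using q by (simp add: pos_imp_zdiv_nonneg_iff)
  ultimately have 1: "int N \<le> (2 * int N div q + 1) * int k" by simp
  have "(2 * int N div q) * (4 * int k + 4) \<le> (2 * int N div q) * q"
    using \<open>2 * int N div q \<ge> 0\<close> assms(3) by (intro mult_left_mono) auto
  also have "\<dots> \<le> 2 * int N" using q
    by (metis minus_mod_eq_div_mult pos_mod_sign diff_le_eq le_add_same_cancel1)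
  finally have "4 * ((2 * int N div q) * int k) \<le> 2 * int N"
    using \<open>2 * int N div q \<ge> 0\<close> by (simp add: algebra_simps)
  with 1 have "2 * int N \<le> 4 * int k" by (simp add: algebra_simps)
  then show False unfolding N_def by simp
qed

lemma inconsistent: False
proof -
  obtain p q p' q' where *: "0 \<le> p" "0 < q" "0 \<le> p'" "0 < q'" "p' * q - p * q' = 1"
    "q + q' \<ge> int (8 * k + 8) + 2"
    "\<forall>\<^sub>F i in sequentially. p * int i \<le> q * f i \<and> q' * f i \<le> p' * int i"
    using farey_neighbours[of "8 * k + 8"] by blast
  \<comment> \<open>With determinant 1, \<open>i\<close> is a sum of two terms that are eventually
    nonnegative, so each is at most \<open>i\<close>. This gives a thin strip above the lower line
    if \<open>q'\<close> is large and below the upper line if \<open>q\<close> is large.\<close>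
  have id: "q' * (q * f i - p * int i) + q * (p' * int i - q' * f i) = int i" for i
  proof -
    have "q' * (q * f i - p * int i) + q * (p' * int i - q' * f i) = (p' * q - p * q') * int i"
      by (simp add: algebra_simps)
    then show ?thesis using *(5) by simp
  qed
  have "q' \<ge> 4 * int k + 4 \<or> q \<ge> 4 * int k + 4" using *(6) by auto
  then show False
  proof
    assume q': "q' \<ge> 4 * int k + 4"
    show False
    proof (rule not_eventually_thin[OF *(2) _ q', of 1 p])
      show "\<forall>\<^sub>F i in sequentially. 0 \<le> 1 * (q * f i - p * int i) \<and> q' * (1 * (q * f i - p * int i)) \<le> int i"
        using *(7)
      proof eventually_elim
        case (elim i)
        then have "0 \<le> q * (p' * int i - q' * f i)" using *(2) by simp
        with elim id[of i] show ?case by simp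
      qed
    qed simp
  next
    assume q: "q \<ge> 4 * int k + 4"
    show False
    proof (rule not_eventually_thin[OF *(4) _ q, of "-1" p'])
      show "\<forall>\<^sub>F i in sequentially. 0 \<le> -1 * (q' * f i - p' * int i) \<and> q * (-1 * (q' * f i - p' * int i)) \<le> int i"
        using *(7)
      proof eventually_elim
        case (elim i)
        then have "0 \<le> q' * (q * f i - p * int i)" using *(4) by simp
        with elim id[of i] show ?case by simp
      qed
    qed simp
  qed
qed

end

section \<open>Compactness: from arbitrarily long finite paths to an infinite path\<close>

lemma has_k_collinear_mono:
  "has_k_collinear k V \<Longrightarrow> V \<subseteq> W \<Longrightarrow> has_k_collinear k W"
  unfolding has_k_collinear_def by (elim exE conjE) (intro exI conjI, rule subset_trans, assumption+)

text \<open>Initial segments inherit the absence of \<open>k\<close> collinear vertices, so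
  unbounded lengths give paths of every length and, by \<open>konig_bool\<close>, a limit sequence.
  Any \<open>k\<close> collinear points of the limit already lie on one of the finite paths.\<close>

lemma finite_moves:
  "finite {n. \<exists>p. ne_path n p \<and> \<not> has_k_collinear k (visited n p)}"
proof (rule ccontr)
  assume inf: "infinite {n. \<exists>p. ne_path n p \<and> \<not> has_k_collinear k (visited n p)}"
  have "\<exists>p. ne_path n p \<and> \<not> has_k_collinear k (visited n p)" for n
  proof -
    obtain n' p where "n' \<ge> n" "ne_path n' p" "\<not> has_k_collinear k (visited n' p)"
      using inf unfolding infinite_nat_iff_unbounded_le by blast
    moreover from this have "visited n p \<subseteq> visited n' p" unfolding visited_def by auto
    ultimately show ?thesis using has_k_collinear_mono unfolding ne_path_def
      by (metis (no_types, lifting) order_less_le_trans)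
  qed
  then obtain P where P: "\<And>n. ne_path n (P n)" "\<And>n. \<not> has_k_collinear k (visited n (P n))" by metis
  obtain d where d: "\<And>L. \<exists>n\<ge>L. \<forall>i<L. (snd (P n (Suc i)) \<noteq> snd (P n i)) = d i"
    using konig_bool[of "\<lambda>n i. snd (P n (Suc i)) \<noteq> snd (P n i)"] by blast
  define f :: "nat \<Rightarrow> int" where "f i = (\<Sum>j<i. if d j then 1 else 0)" for i
  have agree: "\<exists>n\<ge>L. \<forall>i\<le>L. P n i = (int i - f i, f i)" for L
  proof -
    obtain n where n: "n \<ge> L" "\<And>i. i < L \<Longrightarrow> (snd (P n (Suc i)) \<noteq> snd (P n i)) = d i" using d[of L] by blast
    have snd: "snd (P n i) = f i" if "i \<le> L" for i
      using that
    proof (induction i)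
      case (Suc i)
      then have "P n (Suc i) - P n i \<in> {(1, 0), (0, 1)}" using P(1)[of n] n(1) unfolding ne_path_def by auto
      then have "snd (P n (Suc i)) = snd (P n i) + (if d i then 1 else 0)"
        using n(2)[of i] Suc.prems by (cases "P n i"; cases "P n (Suc i)") auto
      with Suc show ?case unfolding f_def by simp
    qed (use P(1)[of n] in \<open>simp add: f_def ne_path_def\<close>)
    have "P n i = (int i - f i, f i)" if "i \<le> L" for i
      using snd[OF that] ne_path_sum[OF P(1), of i n] that n(1) by (simp add: prod_eq_iff)
    with n(1) show ?thesis by blast
  qed
  interpret ne_sequence f k
  proof
    fix a b t :: int assume b: "b > 0"
    let ?A = "{i. b * f i - a * int i = t}"
    show "finite ?A \<and> card ?A < k"
    proof (rule ccontr)
      assume "\<not> (finite ?A \<and> card ?A < k)"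
      then obtain I where I: "I \<subseteq> ?A" "card I = k" "finite I"
      proof (cases "finite ?A")
        case True
        then have "k \<le> card ?A" using \<open>\<not> (finite ?A \<and> card ?A < k)\<close> by linarith
        then show ?thesis by (rule obtain_subset_with_card_n) (rule that)
      next
        case False
        then show ?thesis using infinite_arbitrarily_large[of ?A k] that by blast
      qed
      then obtain L where L: "\<And>i. i \<in> I \<Longrightarrow> i \<le> L" using Max_ge by blast
      obtain n where n: "n \<ge> L" "\<And>i. i \<le> L \<Longrightarrow> P n i = (int i - f i, f i)" using agree[of L] by blast
      have "inj_on (P n) I" using n L by (auto simp: inj_on_def)
      then have "card (P n ` I) = k" using I card_image by blast
      moreover have "P n ` I \<subseteq> visited n (P n)" unfolding visited_def
        by (rule image_mono) (use n(1) L in \<open>force intro: order_trans\<close>)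
      moreover have "collinear (to_plane ` (P n ` I))"
        by (rule collinear_to_plane[where a = a and b = b and t = t]) (use I L n b in auto)
      ultimately show False using P(2)[of n] unfolding has_k_collinear_def by blast
    qed
  qed (auto simp: f_def)
  show False by (rule inconsistent)
qed

subsection \<open>Random slopes on dyadic blocks\<close>

text \<open>Fubini for counting: the coordinate \<open>w\<close> is split off from the
  others.\<close>

lemma card_PiE_fibres:
  assumes "finite V" "w \<in> V" "finite B"
  shows "card {X \<in> PiE V (\<lambda>_. B). R X} = (\<Sum>X\<in>PiE (V - {w}) (\<lambda>_. B). card {x \<in> B. R (X(w := x))})"
proof -
  let ?V = "V - {w}"
  have V: "V = insert w ?V" using assms by auto
  have "inj_on (\<lambda>(X, x). X(w := x)) (PiE ?V (\<lambda>_. B) \<times> B)"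
  proof (rule inj_onI, clarify)
    fix X x Y y
    assume X: "X \<in> PiE ?V (\<lambda>_. B)" and Y: "Y \<in> PiE ?V (\<lambda>_. B)" and eq: "X(w := x) = Y(w := y)"
    have "X v = Y v" for v
      using fun_cong[OF eq, of v] PiE_arb[OF X, of w] PiE_arb[OF Y, of w] by (cases "v = w") auto
    moreover have "x = y" using fun_cong[OF eq, of w] by simp
    ultimately show "X = Y \<and> x = y" by blast
  qed
  then have inj: "inj_on (\<lambda>(X, x). X(w := x)) (SIGMA X:PiE ?V (\<lambda>_. B). {x \<in> B. R (X(w := x))})"
    by (rule inj_on_subset) auto
  have "{X \<in> PiE V (\<lambda>_. B). R X} = (\<lambda>(X, x). X(w := x)) ` (SIGMA X:PiE ?V (\<lambda>_. B). {x \<in> B. R (X(w := x))})"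
    (is "?L = ?g ` ?S")
  proof
    show "?L \<subseteq> ?g ` ?S"
    proof
      fix X assume X: "X \<in> ?L"
      \<comment> \<open>The reset to \<open>undefined\<close> makes the restriction extensional on
        \<open>V - {w}\<close>.\<close>
      have "X = ?g (X(w := undefined), X w)" by simp
      moreover have "(X(w := undefined), X w) \<in> ?S"
        using X assms(2) by (auto simp: PiE_iff extensional_def)
      ultimately show "X \<in> ?g ` ?S" by blast
    qed
    show "?g ` ?S \<subseteq> ?L"
    proof
      fix Y assume "Y \<in> ?g ` ?S"
      then obtain X x where "X \<in> PiE ?V (\<lambda>_. B)" "x \<in> B" "R (X(w := x))" "Y = X(w := x)" by auto
      then show "Y \<in> ?L"
        using PiE_fun_upd[of x "\<lambda>_. B" w X ?V] V by simp
    qed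
  qed
  then have "card ?L = card ?S" using card_image[OF inj] by simp
  also have "\<dots> = (\<Sum>X\<in>PiE ?V (\<lambda>_. B). card {x \<in> B. R (X(w := x))})"
    by (rule card_SigmaI) (use assms in \<open>auto intro!: finite_PiE\<close>)
  finally show ?thesis .
qed

text \<open>A conditional probability bound in counting form: on each fibre in direction
  \<open>w\<close>, the condition \<open>P\<close> is constant and \<open>Q\<close> has density at
  most \<open>c\<close>.\<close>

lemma card_PiE_conj_le:
  fixes c :: real
  assumes "finite V" "w \<in> V" "finite B"
    and indep: "\<And>X x. P (X(w := x)) = P X"
    and le: "\<And>X. real (card {x \<in> B. Q (X(w := x))}) \<le> c * card B"
  shows "real (card {X \<in> PiE V (\<lambda>_. B). P X \<and> Q X}) \<le> c * card {X \<in> PiE V (\<lambda>_. B). P X}"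
proof -
  have "real (card {x \<in> B. P (X(w := x)) \<and> Q (X(w := x))}) \<le> c * real (card {x \<in> B. P (X(w := x))})"
    for X using le[of X] by (cases "P X") (simp_all add: indep)
  then show ?thesis
    unfolding card_PiE_fibres[OF assms(1-3)] of_nat_sum sum_distrib_left by (intro sum_mono)
qed

text \<open>Unless the gap is 1, take the largest power of two that is at most half of
  \<open>b - a\<close>, and round \<open>a\<close> up to a multiple of it; the rounding uses up at
  most half of the gap.\<close>

lemma exists_dyadic_block:
  assumes "(a::nat) < b"
  obtains l q where "a \<le> q * 2 ^ l" "(q + 1) * 2 ^ l \<le> b" "b - a < 4 * 2 ^ l"
proof (cases "b - a = 1")
  case True
  then show ?thesis using that[of a 0] by auto
next
  case False
  define r where "r = b - a"
  have r: "r \<ge> 2" using False assms unfolding r_def by linarith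
  obtain l where l: "2 ^ l \<le> r div 2" "r div 2 < 2 ^ (l + 1)"
    using ex_power_ivl1[of 2 "r div 2"] r by (auto simp: Suc_le_eq div_greater_zero_iff)
  define q where "q = (a + (2 ^ l - 1)) div 2 ^ l"
  have "q * 2 ^ l + (a + (2 ^ l - 1)) mod 2 ^ l = a + (2 ^ l - 1)" unfolding q_def by (rule div_mult_mod_eq)
  moreover have "(a + (2 ^ l - 1)) mod 2 ^ l < 2 ^ l" by simp
  ultimately have q: "a \<le> q * 2 ^ l" "q * 2 ^ l \<le> a + 2 ^ l" by linarith+
  show ?thesis
  proof (rule that[of q l])
    show "(q + 1) * 2 ^ l \<le> b" using q l r unfolding r_def by (simp add: algebra_simps)
    show "b - a < 4 * 2 ^ l" using l unfolding r_def by simp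
  qed (use q in simp)
qed

text \<open>The solutions lie in an interval of length \<open>2 * e / d\<close>. The
  \<open>max 0\<close> covers the empty case, where \<open>e\<close> may be negative.\<close>

lemma card_nat_in_open_interval:
  fixes d e r :: real
  assumes "d > 0" "finite B"
  shows "real (card {x \<in> B. \<bar>d * real (x::nat) + r\<bar> < e}) \<le> max 0 (2 * e / d + 1)"
proof (cases "{x \<in> B. \<bar>d * real x + r\<bar> < e} = {}")
  case True
  show ?thesis unfolding True by simp
next
  case False
  let ?T = "{x \<in> B. \<bar>d * real x + r\<bar> < e}"
  have fin: "finite ?T" using assms by simp
  have M: "Max ?T \<in> ?T" "Min ?T \<in> ?T" using Max_in[OF fin False] Min_in[OF fin False] by blast+
  have "?T \<subseteq> {Min ?T..Max ?T}" using fin by (auto intro!: Min_le Max_ge)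
  then have "card ?T \<le> card {Min ?T..Max ?T}" by (rule card_mono[rotated]) simp
  moreover have mm: "Min ?T \<le> Max ?T" using Min_le[OF fin M(1)] .
  ultimately have "real (card ?T) \<le> real (Max ?T) - real (Min ?T) + 1" by simp
  moreover have "d * (real (Max ?T) - real (Min ?T)) \<le> 2 * e"
    using M by (simp add: algebra_simps) linarith
  then have "real (Max ?T) - real (Min ?T) \<le> 2 * e / d" using assms by (simp add: field_simps)
  ultimately show ?thesis by linarith
qed

text \<open>The entry \<open>X (l, q)\<close> belongs to the dyadic block \<open>[q 2^l, (q + 1) 2^l)\<close> and contributes
  \<open>X (l, q) / scale m\<close> to the slope of the path throughout that block.\<close>

definition slope_data :: "nat \<Rightarrow> (nat \<times> nat \<Rightarrow> nat) set" where
  "slope_data m = PiE ({..m} \<times> {..<2 ^ m}) (\<lambda>_. {..<2 ^ m})"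

lemma finite_slope_data: "finite (slope_data m)"
  unfolding slope_data_def by (intro finite_PiE) auto

text \<open>A sum of \<open>m + 1\<close> entries below \<open>2 ^ m\<close> is less than this
  number, so slopes lie in [0, 1) after division. Keeping heights undivided keeps them
  integral.\<close>

definition scale :: "nat \<Rightarrow> nat" where
  "scale m = (m + 1) * 2 ^ m"

definition height :: "nat \<Rightarrow> (nat \<times> nat \<Rightarrow> nat) \<Rightarrow> nat \<Rightarrow> nat" where
  "height m X i = (\<Sum>j<i. \<Sum>l\<le>m. X (l, j div 2 ^ l))"

text \<open>This is what remains of collinearity after undoing the rounding, which affects height
  differences by less than \<open>scale m\<close>. Comparing pairs eliminates the intercept, so the
  union bound runs over slopes only.\<close>

definition near_line :: "nat \<Rightarrow> real \<Rightarrow> (nat \<times> nat \<Rightarrow> nat) \<Rightarrow> nat set \<Rightarrow> bool" where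
  "near_line m s X S \<longleftrightarrow> (\<forall>a\<in>S. \<forall>b\<in>S. a < b \<longrightarrow>
     \<bar>real (height m X b) - real (height m X a) - s * (real b - real a)\<bar> < scale m)"

text \<open>The height is affine in each single entry; setting the entry to 0 isolates the constant
  term.\<close>

lemma height_upd:
  assumes "l \<le> m"
  shows "height m (X((l, q) := x)) i = height m (X((l, q) := 0)) i + x * card {j. j < i \<and> j div 2 ^ l = q}"
proof -
  have "(\<Sum>l'\<le>m. (X((l, q) := x)) (l', j div 2 ^ l')) =
     (\<Sum>l'\<le>m. (X((l, q) := 0)) (l', j div 2 ^ l')) + (if j div 2 ^ l = q then x else 0)" for j
  proof -
    have "(\<Sum>l'\<le>m. (X((l, q) := x)) (l', j div 2 ^ l')) =
      (\<Sum>l'\<le>m. (X((l, q) := 0)) (l', j div 2 ^ l') + (if l' = l then if j div 2 ^ l = q then x else 0 else 0))"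
      by (rule sum.cong) auto
    also have "\<dots> = (\<Sum>l'\<le>m. (X((l, q) := 0)) (l', j div 2 ^ l')) + (if j div 2 ^ l = q then x else 0)"
      unfolding sum.distrib using assms by (simp add: sum.delta)
    finally show ?thesis .
  qed
  then have "height m (X((l, q) := x)) i =
     height m (X((l, q) := 0)) i + (\<Sum>j<i. if j div 2 ^ l = q then x else 0)"
    unfolding height_def sum.distrib[symmetric] by (intro sum.cong) auto
  also have "(\<Sum>j<i. if j div 2 ^ l = q then x else 0) = x * card {j. j < i \<and> j div 2 ^ l = q}"
    by (simp add: sum.If_cases Collect_conj_eq lessThan_def)
  finally show ?thesis .
qed

lemma height_upd_before:
  assumes "l \<le> m" "i \<le> q * 2 ^ l"
  shows "height m (X((l, q) := x)) i = height m X i"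
proof -
  have "\<And>j. j < i \<Longrightarrow> j div 2 ^ l \<noteq> q"
  proof
    fix j assume j: "j < i" "j div 2 ^ l = q"
    have "q * 2 ^ l \<le> j" unfolding j(2)[symmetric] by simp
    with j assms show False by linarith
  qed
  then have e: "{j. j < i \<and> j div 2 ^ l = q} = {}" by blast
  show ?thesis
    using height_upd[OF assms(1), of X q x i] height_upd[OF assms(1), of X q "X (l, q)" i] unfolding e by simp
qed

lemma height_upd_after:
  assumes "l \<le> m" "(q + 1) * 2 ^ l \<le> i"
  shows "height m (X((l, q) := x)) i = height m (X((l, q) := 0)) i + x * 2 ^ l"
proof -
  have "{j. j < i \<and> j div 2 ^ l = q} = {q * 2 ^ l..<(q + 1) * 2 ^ l}" (is "?L = ?R")
  proof
    show "?L \<subseteq> ?R" using dividend_less_div_times[of "2 ^ l :: nat"]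
      by (auto simp: algebra_simps)
    show "?R \<subseteq> ?L"
      using assms(2) by (auto intro!: div_nat_eqI simp: algebra_simps)
  qed
  then show ?thesis using height_upd[OF assms(1), of X q x i] by simp
qed

text \<open>The interval from \<open>a\<close> to \<open>b\<close> contains a dyadic block comparable with \<open>b - a\<close>.  The entry of this
  block does not influence the heights up to \<open>a\<close>, hence not the condition on \<open>S\<close>, whereas the
  new condition confines it to a short interval.\<close>

lemma near_line_insert_le:
  assumes "finite S" "S \<subseteq> {..a}" "a \<in> S" "a < b" "b \<le> 2 ^ m"
  shows "real (card {X \<in> slope_data m. near_line m s X (insert b S)})
    \<le> 12 * (real m + 1) / real (b - a) * card {X \<in> slope_data m. near_line m s X S}"
proof -
  obtain l q where lq: "a \<le> q * 2 ^ l" "(q + 1) * 2 ^ l \<le> b" "b - a < 4 * 2 ^ l"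
    using exists_dyadic_block[OF assms(4)] .
  have pl: "(2::nat) ^ l \<le> 2 ^ m"
  proof -
    have "2 ^ l \<le> (q + 1) * (2::nat) ^ l" by simp
    with lq assms show ?thesis by linarith
  qed
  then have l: "l \<le> m" by simp
  have "q * 1 \<le> q * 2 ^ l" by (rule mult_le_mono) auto
  moreover have "q * 2 ^ l < (q + 1) * (2::nat) ^ l" by simp
  ultimately have q: "q < 2 ^ m" using lq assms by linarith
  define Q where "Q X \<longleftrightarrow> \<bar>real (height m X b) - real (height m X a) - s * (real b - real a)\<bar> < scale m" for X
  \<comment> \<open>The factor 12 is 3 * 4: the interval length plus one extra point is at most
    \<open>3 * scale m / 2 ^ l\<close>, and \<open>b - a < 4 * 2 ^ l\<close> costs the 4.\<close>
  have "real (card {x \<in> {..<2 ^ m}. Q (X((l, q) := x))}) \<le> 12 * (real m + 1) / real (b - a) * card {..<(2::nat) ^ m}" for X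
  proof -
    define r where "r = real (height m (X((l, q) := 0)) b) - real (height m X a) - s * (real b - real a)"
    have "Q (X((l, q) := x)) \<longleftrightarrow> \<bar>2 ^ l * real x + r\<bar> < scale m" for x
      unfolding Q_def r_def height_upd_before[OF l lq(1)] height_upd_after[OF l lq(2), of X x]
      by (simp add: algebra_simps)
    then have "real (card {x \<in> {..<2 ^ m}. Q (X((l, q) := x))}) \<le> max 0 (2 * scale m / 2 ^ l + 1)"
      using card_nat_in_open_interval[of "2 ^ l" "{..<2 ^ m}" r "scale m"] by simp
    also have "\<dots> = (2 * scale m + 2 ^ l) / 2 ^ l" by (simp add: field_simps)
    also have "\<dots> \<le> (2 * scale m + 2 ^ m) / 2 ^ l"
      using pl by (intro divide_right_mono) (simp_all add: of_nat_mono flip: of_nat_power)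
    also have "\<dots> \<le> 3 * (m + 1) * 2 ^ m / 2 ^ l"
      by (intro divide_right_mono) (simp_all add: scale_def algebra_simps)
    also have "\<dots> \<le> 12 * (real m + 1) * 2 ^ m / real (b - a)"
    proof -
      have "real (b - a) < 4 * 2 ^ l" using lq(3) by (metis of_nat_less_iff of_nat_mult of_nat_numeral of_nat_power)
      then have "1 / 2 ^ l \<le> 4 / real (b - a)" using assms(4) by (simp add: field_simps)
      then have "3 * (m + 1) * 2 ^ m * (1 / 2 ^ l) \<le> 3 * (m + 1) * 2 ^ m * (4 / real (b - a))"
        by (intro mult_left_mono) auto
      then show ?thesis by (simp add: field_simps)
    qed
    finally show ?thesis by simp
  qed
  moreover have "near_line m s (X((l, q) := x)) S = near_line m s X S" for X x
  proof -
    have "c \<in> S \<Longrightarrow> height m (X((l, q) := x)) c = height m X c" for c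
      using assms(2) lq(1) by (intro height_upd_before[OF l]) auto
    then show ?thesis unfolding near_line_def by simp
  qed
  ultimately have le: "real (card {X \<in> slope_data m. near_line m s X S \<and> Q X})
    \<le> 12 * (real m + 1) / real (b - a) * card {X \<in> slope_data m. near_line m s X S}"
    unfolding slope_data_def using l q by (intro card_PiE_conj_le[where w = "(l, q)"]) auto
  \<comment> \<open>Of the new conditions only the one for the pair \<open>(a, b)\<close> is
    kept.\<close>
  have sub: "{X \<in> slope_data m. near_line m s X (insert b S)} \<subseteq> {X \<in> slope_data m. near_line m s X S \<and> Q X}"
    using assms unfolding near_line_def Q_def by auto
  then have "card {X \<in> slope_data m. near_line m s X (insert b S)} \<le> card {X \<in> slope_data m. near_line m s X S \<and> Q X}"
    by (rule card_mono[rotated]) (simp add: finite_slope_data)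
  then show ?thesis by (intro order_trans[OF of_nat_mono le])
qed

subsection \<open>The first moment bound\<close>

text \<open>Fixing the largest element allows sets to be built from left to right, each new point
  lying beyond the previous maximum.\<close>

definition chains :: "nat \<Rightarrow> nat \<Rightarrow> nat set set" where
  "chains k b = {S. S \<subseteq> {..b} \<and> b \<in> S \<and> card S = k}"

lemma finite_chains: "finite (chains k b)"
  unfolding chains_def by (rule finite_subset[of _ "Pow {..b}"]) auto

lemma chains_Suc_subset:
  assumes "k > 0"
  shows "chains (Suc k) b \<subseteq> (\<lambda>(a, S). insert b S) ` (SIGMA a:{..<b}. chains k a)"
proof
  fix T assume T: "T \<in> chains (Suc k) b"
  define S where "S = T - {b}"
  have fin: "finite T" using T finite_subset unfolding chains_def by blast
  have S: "S \<subseteq> {..<b}" "card S = k" "T = insert b S" "finite S"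
    using T fin unfolding chains_def S_def by (auto simp: order_less_le)
  then have ne: "S \<noteq> {}" using assms by auto
  then have "Max S \<in> S" using S(4) by simp
  moreover have "S \<subseteq> {..Max S}" using S(4) by auto
  ultimately have "(Max S, S) \<in> (SIGMA a:{..<b}. chains k a)" using S unfolding chains_def by auto
  then show "T \<in> (\<lambda>(a, S). insert b S) ` (SIGMA a:{..<b}. chains k a)" using S(3) by force
qed

text \<open>Each dyadic range of indices contributes at most 1.\<close>

lemma harm_power_of_two_le: "harm (2 ^ m) \<le> real m + 1"
proof (induction m)
  case (Suc m)
  have "harm (2 ^ Suc m) = (\<Sum>k\<in>{1..2 ^ m} \<union> {2 ^ m + 1..2 ^ Suc m}. inverse (real k))"
    unfolding harm_def by (rule sum.cong) auto
  also have "\<dots> = harm (2 ^ m) + (\<Sum>k\<in>{2 ^ m + 1..2 ^ Suc m}. inverse (real k))"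
    unfolding harm_def by (rule sum.union_disjoint) auto
  also have "(\<Sum>k\<in>{2 ^ m + 1..2 ^ Suc m}. inverse (real k)) \<le> (\<Sum>k\<in>{2 ^ m + 1..(2::nat) ^ Suc m}. inverse (2 ^ m))"
  proof (intro sum_mono)
    fix k assume "k \<in> {2 ^ m + 1..(2::nat) ^ Suc m}"
    then have "2 ^ m \<le> k" by simp
    then have "2 ^ m \<le> real k" by (metis of_nat_le_iff of_nat_numeral of_nat_power)
    then show "inverse (real k) \<le> inverse (2 ^ m)" by (intro le_imp_inverse_le) auto
  qed
  also have "\<dots> = 1" by simp
  finally show ?case using Suc by simp
qed (simp add: harm_def)

lemma sum_inverse_gaps_le:
  assumes "b \<le> 2 ^ m"
  shows "(\<Sum>a<b. 1 / real (b - a)) \<le> real m + 1"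
proof -
  have "(\<Sum>a<b. 1 / real (b - a)) = harm b"
    unfolding harm_def
    by (rule sum.reindex_bij_witness[of _ "\<lambda>r. b - r" "\<lambda>a. b - a"]) (auto simp: field_simps)
  also have "\<dots> \<le> harm (2 ^ m)" using assms by (intro harm_mono)
  also note harm_power_of_two_le
  finally show ?thesis .
qed

text \<open>Induction on the number of points: adding a largest point \<open>b\<close> after
  \<open>a\<close> costs \<open>12 * (m + 1) / (b - a)\<close>, and summing over \<open>a\<close>
  gives another \<open>m + 1\<close>.\<close>

lemma sum_chains_near_line_le:
  assumes "b \<le> 2 ^ m"
  shows "(\<Sum>S\<in>chains (Suc k) b. real (card {X \<in> slope_data m. near_line m s X S}))
    \<le> (12 * (real m + 1)\<^sup>2) ^ k * card (slope_data m)"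
  using assms
proof (induction k arbitrary: b)
  case 0
  have "chains (Suc 0) b = {{b}}" unfolding chains_def by (auto simp: card_Suc_eq)
  moreover have "near_line m s X {b}" for X unfolding near_line_def by simp
  ultimately show ?case by simp
next
  case (Suc k)
  let ?N = "\<lambda>S. real (card {X \<in> slope_data m. near_line m s X S})"
  let ?I = "SIGMA a:{..<b}. chains (Suc k) a"
  have fin: "finite ?I" by (simp add: finite_chains)
  have "sum ?N (chains (Suc (Suc k)) b) \<le> sum ?N ((\<lambda>(a, S). insert b S) ` ?I)"
    by (rule sum_mono2) (use chains_Suc_subset[of "Suc k" b] fin in auto)
  also have "\<dots> \<le> sum (?N \<circ> (\<lambda>(a, S). insert b S)) ?I"
    by (rule sum_image_le) (use fin in auto)
  also have "\<dots> = (\<Sum>a<b. \<Sum>S\<in>chains (Suc k) a. ?N (insert b S))"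
    by (subst sum.Sigma) (auto simp: finite_chains case_prod_beta)
  also have "\<dots> \<le> (\<Sum>a<b. \<Sum>S\<in>chains (Suc k) a. 12 * (real m + 1) / real (b - a) * ?N S)"
  proof (intro sum_mono)
    fix a S assume "a \<in> {..<b}" "S \<in> chains (Suc k) a"
    then show "?N (insert b S) \<le> 12 * (real m + 1) / real (b - a) * ?N S"
      using Suc.prems finite_subset[of S "{..a}"] by (intro near_line_insert_le) (auto simp: chains_def)
  qed
  also have "\<dots> = (\<Sum>a<b. 12 * (real m + 1) / real (b - a) * (\<Sum>S\<in>chains (Suc k) a. ?N S))"
    by (simp add: sum_distrib_left)
  also have "\<dots> \<le> (\<Sum>a<b. 12 * (real m + 1) / real (b - a) * ((12 * (real m + 1)\<^sup>2) ^ k * card (slope_data m)))"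
    using Suc.prems by (intro sum_mono mult_left_mono Suc.IH) auto
  also have "\<dots> = (\<Sum>a<b. 1 / real (b - a)) * (12 * (real m + 1) * ((12 * (real m + 1)\<^sup>2) ^ k * card (slope_data m)))"
    by (simp add: sum_distrib_right)
  also have "\<dots> \<le> (real m + 1) * (12 * (real m + 1) * ((12 * (real m + 1)\<^sup>2) ^ k * card (slope_data m)))"
    by (intro mult_right_mono sum_inverse_gaps_le Suc.prems) auto
  also have "\<dots> = (12 * (real m + 1)\<^sup>2) ^ Suc k * card (slope_data m)"
    by (simp add: power2_eq_square)
  finally show ?case .
qed

text \<open>After exchanging the sums, the sets are grouped by their maximum, which has
  \<open>2 ^ m + 1\<close> possible values.\<close>

lemma sum_near_line_le:
  assumes "k > 0"
  shows "(\<Sum>X\<in>slope_data m. real (card {S. S \<subseteq> {..2 ^ m} \<and> card S = k \<and> near_line m s X S}))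
    \<le> (2 ^ m + 1) * (12 * (real m + 1)\<^sup>2) ^ (k - 1) * card (slope_data m)"
proof -
  let ?N = "\<lambda>S. real (card {X \<in> slope_data m. near_line m s X S})"
  define F where "F = {S. S \<subseteq> {..(2::nat) ^ m} \<and> card S = k}"
  have finF: "finite F" unfolding F_def by (rule finite_subset[of _ "Pow {..2 ^ m}"]) auto
  have "(\<Sum>X\<in>slope_data m. real (card {S. S \<subseteq> {..2 ^ m} \<and> card S = k \<and> near_line m s X S}))
    = (\<Sum>X\<in>slope_data m. \<Sum>S\<in>F. if near_line m s X S then 1 else 0)"
    using finF by (intro sum.cong refl) (simp add: sum.If_cases F_def Int_def conj_assoc)
  also have "\<dots> = (\<Sum>S\<in>F. \<Sum>X\<in>slope_data m. if near_line m s X S then 1 else 0)" by (rule sum.swap)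
  also have "\<dots> = (\<Sum>S\<in>F. ?N S)"
    by (intro sum.cong refl) (simp add: sum.If_cases finite_slope_data Int_def)
  also have "\<dots> \<le> sum ?N (\<Union>b\<in>{..2 ^ m}. chains k b)"
  proof (rule sum_mono2)
    show "F \<subseteq> (\<Union>b\<in>{..2 ^ m}. chains k b)"
    proof
      fix S assume S: "S \<in> F"
      then have "finite S" "S \<noteq> {}" using assms finite_subset unfolding F_def by (blast, force)
      then have "S \<in> chains k (Max S)" "Max S \<in> {..2 ^ m}"
        using S Max_in[of S] unfolding F_def chains_def by auto
      then show "S \<in> (\<Union>b\<in>{..2 ^ m}. chains k b)" by blast
    qed
  qed (auto simp: finite_chains)
  also have "\<dots> \<le> (\<Sum>b\<le>2 ^ m. sum ?N (chains k b))"
  proof -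
    have "(\<Union>b\<in>{..2 ^ m}. chains k b) = snd ` (SIGMA b:{..2 ^ m}. chains k b)" by force
    moreover have "sum ?N (snd ` (SIGMA b:{..2 ^ m}. chains k b)) \<le> sum (?N \<circ> snd) (SIGMA b:{..2 ^ m}. chains k b)"
      by (rule sum_image_le) (auto simp: finite_chains)
    moreover have "sum (?N \<circ> snd) (SIGMA b:{..2 ^ m}. chains k b) = (\<Sum>b\<le>2 ^ m. sum ?N (chains k b))"
      by (subst sum.Sigma) (auto simp: finite_chains case_prod_beta)
    ultimately show ?thesis by simp
  qed
  also have "\<dots> \<le> (\<Sum>b\<le>(2::nat) ^ m. (12 * (real m + 1)\<^sup>2) ^ (k - 1) * card (slope_data m))"
    using sum_chains_near_line_le[where k = "k - 1"] assms by (intro sum_mono) auto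
  also have "\<dots> = (2 ^ m + 1) * (12 * (real m + 1)\<^sup>2) ^ (k - 1) * card (slope_data m)" by simp
  finally show ?thesis .
qed

text \<open>If every choice of data failed for some slope, the counts summed over all slopes would
  be at least the binomial coefficient for every choice, contradicting the first moment
  bound.\<close>

lemma exists_slope_data_few_near:
  "\<exists>X\<in>slope_data m. \<forall>p\<le>2 ^ m. \<forall>q\<in>{1..2 ^ m}.
    card {S. S \<subseteq> {..2 ^ m} \<and> card S = 4 * (m + 1) \<and> near_line m (scale m * (real p / real q)) X S}
      < (96 * (m + 1) ^ 3) choose (4 * (m + 1))"
proof (rule ccontr)
  define k where "k = 4 * (m + 1)"
  define A where "A = 12 * (real m + 1)\<^sup>2"
  define B where "B = (96 * (m + 1) ^ 3) choose k"
  define P where "P = {..(2::nat) ^ m} \<times> {1..(2::nat) ^ m}"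
  let ?c = "\<lambda>X (p, q). real (card {S. S \<subseteq> {..2 ^ m} \<and> card S = k \<and> near_line m (scale m * (real p / real q)) X S})"
  assume "\<not> ?thesis"
  then have ex: "\<exists>z\<in>P. real B \<le> ?c X z" if "X \<in> slope_data m" for X
    using that unfolding B_def k_def P_def by (fastforce simp: not_less)
  have finP: "finite P" unfolding P_def by simp
  have cardP: "real (card P) = (2 ^ m + 1) * 2 ^ m" unfolding P_def by (simp add: algebra_simps)
  have ne: "card (slope_data m) > 0"
    unfolding slope_data_def by (simp add: card_PiE)
  have "real B * card (slope_data m) = (\<Sum>X\<in>slope_data m. real B)" by simp
  also have "\<dots> \<le> (\<Sum>X\<in>slope_data m. \<Sum>z\<in>P. ?c X z)"
  proof (intro sum_mono)
    fix X assume "X \<in> slope_data m"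
    then obtain z where "z \<in> P" "real B \<le> ?c X z" using ex by blast
    then show "real B \<le> (\<Sum>z\<in>P. ?c X z)"
      using member_le_sum[of z P "?c X"] finP by (auto simp: case_prod_beta)
  qed
  also have "\<dots> = (\<Sum>z\<in>P. \<Sum>X\<in>slope_data m. ?c X z)" by (rule sum.swap)
  also have "\<dots> \<le> (\<Sum>z\<in>P. (2 ^ m + 1) * A ^ (k - 1) * card (slope_data m))"
    using sum_near_line_le[of k m] unfolding A_def k_def by (intro sum_mono) (auto simp: case_prod_beta)
  also have "\<dots> = (2 ^ m + 1) * 2 ^ m * (2 ^ m + 1) * A ^ (k - 1) * card (slope_data m)"
    unfolding sum_constant cardP by (simp add: mult.assoc)
  finally have le: "real B \<le> (2 ^ m + 1) * 2 ^ m * (2 ^ m + 1) * A ^ (k - 1)"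
    using ne by simp
  \<comment> \<open>The factors count numerators, denominators and largest abscissas. The value of
    \<open>k\<close> is chosen so that \<open>2 ^ k\<close> exceeds their product, and 96 so that
    the quotient in the binomial bound is \<open>2 * A\<close>.\<close>
  have "(2 ^ m + 1) * 2 ^ m * (2 ^ m + 1) \<le> (2 * 2 ^ m) * (2 * 2 ^ m) * (2 * 2 ^ m :: real)"
    by (intro mult_mono) auto
  also have "\<dots> = 8 ^ (m + 1)" using power_mult_distrib[of 2 "2::real"]
    by (simp flip: power_mult_distrib)
  also have "\<dots> < 16 ^ (m + 1)" by (rule power_strict_mono) auto
  also have "(16::real) ^ (m + 1) = 2 ^ k" unfolding k_def power_mult by simp
  finally have lt: "(2 ^ m + 1) * 2 ^ m * (2 ^ m + 1) < (2 ^ k :: real)" .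
  have A: "A \<ge> 1" unfolding A_def using one_le_power[of "real m + 1" 2] by linarith
  have "k \<le> 96 * (m + 1) ^ 3"
    unfolding k_def by (rule mult_le_mono) (auto simp: self_le_power)
  then have "(real (96 * (m + 1) ^ 3) / real k) ^ k \<le> real B"
    unfolding B_def by (rule binomial_ge_n_over_k_pow_k)
  also have "real (96 * (m + 1) ^ 3) / real k = 2 * A"
    unfolding k_def A_def by (simp add: field_simps power2_eq_square power3_eq_cube)
  finally have "2 ^ k * A ^ k \<le> (2 ^ m + 1) * 2 ^ m * (2 ^ m + 1) * A ^ (k - 1)"
    using le by (simp add: power_mult_distrib)
  also have "\<dots> < 2 ^ k * A ^ (k - 1)" using lt A by (intro mult_strict_right_mono) auto
  also have "\<dots> \<le> 2 ^ k * A ^ k" using A by (intro mult_left_mono power_increasing) auto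
  finally show False by simp
qed

section \<open>From slope data to a lattice path\<close>

lemma exists_path:
  "\<exists>p. ne_path (2 ^ m) p \<and> \<not> has_k_collinear (96 * (m + 1) ^ 3) (visited (2 ^ m) p)"
proof -
  define k where "k = 4 * (m + 1)"
  define K where "K = 96 * (m + 1) ^ 3"
  define D where "D = scale m"
  obtain X where X: "X \<in> slope_data m" and few: "\<And>p q. p \<le> 2 ^ m \<Longrightarrow> q \<in> {1..2 ^ m} \<Longrightarrow>
    card {S. S \<subseteq> {..2 ^ m} \<and> card S = k \<and> near_line m (D * (real p / real q)) X S} < K choose k"
    using exists_slope_data_few_near[of m] unfolding k_def K_def D_def by blast
  have D: "D > 0" unfolding D_def scale_def by simp
  define f where "f i = height m X i div D" for i
  define p where "p i = (int i - int (f i), int (f i))" for i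
  \<comment> \<open>One step adds less than \<open>D\<close> to the height, so the quotient rises by
    at most 1.\<close>
  have step: "f (Suc i) = f i \<or> f (Suc i) = Suc (f i)" if "i < 2 ^ m" for i
  proof -
    have "X (l, i div 2 ^ l) \<le> 2 ^ m - 1" if "l \<le> m" for l
    proof -
      have "i div 2 ^ l < 2 ^ m" using \<open>i < 2 ^ m\<close> div_le_dividend[of i "2 ^ l"] by linarith
      then have "X (l, i div 2 ^ l) < 2 ^ m" using X that unfolding slope_data_def by (auto dest: PiE_mem)
      then show ?thesis by simp
    qed
    then have "(\<Sum>l\<le>m. X (l, i div 2 ^ l)) \<le> (\<Sum>l\<le>m. 2 ^ m - 1)" by (intro sum_mono) auto
    also have "\<dots> = (m + 1) * (2 ^ m - 1)" by simp
    also have "\<dots> < D" unfolding D_def scale_def by (intro mult_strict_left_mono) auto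
    finally have "height m X (Suc i) < height m X i + D" "height m X i \<le> height m X (Suc i)"
      unfolding height_def by auto
    then have "f (Suc i) \<le> (height m X i + D) div D" "f i \<le> f (Suc i)"
      unfolding f_def by (intro div_le_mono; simp)+
    then show ?thesis using D unfolding f_def by auto
  qed
  then have "ne_path (2 ^ m) p"
    unfolding ne_path_def p_def by (force simp: f_def height_def)
  have mono: "f i \<le> f j" if "i \<le> j" for i j
    unfolding f_def height_def using that by (intro div_le_mono sum_mono2) auto
  have f_le: "i \<le> 2 ^ m \<Longrightarrow> f i \<le> i" for i
  proof (induction i)
    case (Suc i)
    then show ?case using step[of i] by auto
  qed (simp add: f_def height_def)
  \<comment> \<open>Remainders modulo \<open>D\<close> differ by less than \<open>D\<close>, so
    exact collinearity of rounded points implies nearness of the heights.\<close>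
  have near: "near_line m (D * s) X S" if "\<And>i j. i \<in> S \<Longrightarrow> j \<in> S \<Longrightarrow> real (f j) - real (f i) = s * (real j - real i)" for s :: real and S
    unfolding near_line_def
  proof (intro ballI impI)
    fix i j assume ij: "i \<in> S" "j \<in> S"
    have h: "real (height m X i) = real D * real (f i) + real (height m X i mod D)" for i
      unfolding f_def by (metis mult_div_mod_eq of_nat_add of_nat_mult)
    have "real (height m X j) - real (height m X i) - D * s * (real j - real i)
      = D * (real (f j) - real (f i) - s * (real j - real i)) + (real (height m X j mod D) - real (height m X i mod D))"
      unfolding h[of i] h[of j] by (simp add: algebra_simps)
    also have "\<dots> = real (height m X j mod D) - real (height m X i mod D)" using that[OF ij] by simp
    finally show "\<bar>real (height m X j) - real (height m X i) - D * s * (real j - real i)\<bar> < scale m"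
      using mod_less_divisor[OF D, of "height m X j"] mod_less_divisor[OF D, of "height m X i"]
      unfolding D_def[symmetric] by linarith
  qed
  have "\<not> has_k_collinear K (visited (2 ^ m) p)"
  proof
    assume "has_k_collinear K (visited (2 ^ m) p)"
    then obtain S where S: "S \<subseteq> p ` {..2 ^ m}" "card S = K" "collinear (to_plane ` S)"
      unfolding has_k_collinear_def visited_def by blast
    define I where "I = {i \<in> {..2 ^ m}. p i \<in> S}"
    have SI: "S = p ` I" using S(1) unfolding I_def by auto
    have "inj_on p I" unfolding p_def by (rule inj_onI) auto
    then have cI: "card I = K" using S(2) card_image unfolding SI by metis
    have finI: "finite I" unfolding I_def by simp
    have "K \<ge> 2" unfolding K_def using one_le_power[of "m + 1" 3] by linarith
    then obtain i j where ij: "i \<in> I" "j \<in> I" "i < j"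
      using cI card_le_Suc0_iff_eq[OF finI] by (metis linorder_neqE_nat not_less_eq_eq numeral_2_eq_2)
    obtain u :: "real \<times> real" where u: "\<And>x y. x \<in> to_plane ` S \<Longrightarrow> y \<in> to_plane ` S \<Longrightarrow> \<exists>c. x - y = c *\<^sub>R u"
      using S(3) unfolding collinear_def by blast
    obtain u1 u2 where u12: "u = (u1, u2)" by fastforce
    have c: "\<exists>c. real (f y) - real (f x) = c * u2 \<and> real y - real x = c * (u1 + u2)" if xy: "x \<in> I" "y \<in> I" for x y
    proof -
      obtain c where "to_plane (p y) - to_plane (p x) = c *\<^sub>R u"
        using u[of "to_plane (p y)" "to_plane (p x)"] xy unfolding SI by blast
      then show ?thesis unfolding u12 to_plane_def p_def by (intro exI[of _ c]) (auto simp: algebra_simps)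
    qed
    \<comment> \<open>Distinct vertices have distinct coordinate sums, so the line is not
      antidiagonal and has a finite slope in the coordinates \<open>(x + y, y)\<close>.\<close>
    have u0: "u1 + u2 \<noteq> 0" using c[OF ij(1,2)] ij(3) by auto
    define s where "s = u2 / (u1 + u2)"
    have line: "real (f y) - real (f x) = s * (real y - real x)" if "x \<in> I" "y \<in> I" for x y
      using c[OF that] u0 unfolding s_def by auto
    \<comment> \<open>Two vertices on the line show that its slope is among the fractions covered by
      \<open>few\<close>.\<close>
    have s: "s = real (f j - f i) / real (j - i)"
      using line[OF ij(1,2)] ij(3) mono[of i j] by (simp add: field_simps of_nat_diff)
    have "near_line m (D * s) X T" if "T \<subseteq> I" for T
      by (rule near) (use that line in auto)
    moreover have "I \<subseteq> {..2 ^ m}" unfolding I_def by auto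
    \<comment> \<open>Every \<open>k\<close>-subset of the \<open>K\<close> collinear vertices is
      near the line, which gives \<open>K choose k\<close> such sets, too many for
      \<open>few\<close>.\<close>
    ultimately have "{T. T \<subseteq> I \<and> card T = k} \<subseteq> {T. T \<subseteq> {..2 ^ m} \<and> card T = k \<and> near_line m (D * s) X T}"
      by auto
    moreover have "finite {T. T \<subseteq> {..(2::nat) ^ m} \<and> card T = k \<and> near_line m (D * s) X T}"
      by (rule finite_subset[of _ "Pow {..2 ^ m}"]) auto
    ultimately have "card {T. T \<subseteq> I \<and> card T = k} \<le> card {T. T \<subseteq> {..2 ^ m} \<and> card T = k \<and> near_line m (D * s) X T}"
      by (rule card_mono[rotated])
    also have "\<dots> < K choose k"
      unfolding s
    proof (rule few)
      have "j \<le> 2 ^ m" using ij unfolding I_def by simp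
      then show "f j - f i \<le> 2 ^ m" "j - i \<in> {1..2 ^ m}" using f_le[of j] ij(3) by auto
    qed
    finally show False using n_subsets[OF finI, of k] cI by simp
  qed
  with \<open>ne_path (2 ^ m) p\<close> show ?thesis unfolding K_def by blast
qed

section \<open>The lower bound for general \<open>k\<close>\<close>

lemma has_k_collinear_antimono:
  assumes "has_k_collinear k V" "K \<le> k"
  shows "has_k_collinear K V"
proof -
  obtain S where S: "S \<subseteq> V" "card S = k" "collinear (to_plane ` S)"
    using assms(1) unfolding has_k_collinear_def by blast
  obtain T where "T \<subseteq> S" "card T = K" using obtain_subset_with_card_n[of K S] S(2) assms(2) by blast
  with S collinear_subset[of "to_plane ` S" "to_plane ` T"] show ?thesis
    unfolding has_k_collinear_def by (intro exI[of _ T]) auto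
qed

lemma max_moves_ge:
  assumes "96 * (m + 1) ^ 3 \<le> k"
  shows "2 ^ m \<le> max_moves k"
  unfolding max_moves_def
  using exists_path[of m] has_k_collinear_antimono[OF _ assms] by (intro Max_ge[OF finite_moves]) blast

theorem theorem1p2:
  shows "\<exists>c::real. c > 0 \<and>
    (\<exists>K::nat. \<forall>k\<ge>K. ln (real (max_moves k)) \<ge> c * real k powr (1 / 3))"
proof (intro exI conjI allI impI)
  show "ln 2 / 15 > (0 :: real)" by simp
  \<comment> \<open>The threshold makes 1 admissible in the choice of \<open>m\<close>, so that
    \<open>m \<ge> 1\<close>.\<close>
  fix k :: nat assume k: "k \<ge> 96 * (1 + 1) ^ 3"
  define m where "m = (GREATEST m. 96 * (m + 1) ^ 3 \<le> k)"
  have bd: "n \<le> k" if "96 * (n + 1) ^ 3 \<le> k" for n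
    using that self_le_power[of "n + 1" 3] by linarith
  have m: "96 * (m + 1) ^ 3 \<le> k"
    unfolding m_def by (rule GreatestI_nat[of "\<lambda>m. 96 * (m + 1) ^ 3 \<le> k" 1 k, OF k bd])
  have m1: "m \<ge> 1"
    unfolding m_def by (rule Greatest_le_nat[of "\<lambda>m. 96 * (m + 1) ^ 3 \<le> k" 1 k, OF k bd])
  have "\<not> 96 * (Suc m + 1) ^ 3 \<le> k"
  proof
    assume "96 * (Suc m + 1) ^ 3 \<le> k"
    from Greatest_le_nat[of "\<lambda>m. 96 * (m + 1) ^ 3 \<le> k", OF this bd] show False unfolding m_def by simp
  qed
  moreover have "Suc m + 1 = m + 2" by simp
  ultimately have "k < 96 * (m + 2) ^ 3" by (metis not_le)
  then have "real k < real (96 * (m + 2) ^ 3)" by (simp only: of_nat_less_iff)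
  \<comment> \<open>From \<open>m + 2 \<le> 3 * m\<close> and 96 * 27 = 2592 < 3375 = 15 ^ 3; hence
    the 15 in the constant.\<close>
  also have "\<dots> \<le> (15 * real m) ^ 3"
  proof -
    have "(real m + 2) ^ 3 \<le> (3 * real m) ^ 3" using m1 by (intro power_mono) auto
    also have "\<dots> = 27 * real m ^ 3" by (simp add: power_mult_distrib)
    finally have "(real m + 2) ^ 3 \<le> 27 * real m ^ 3" .
    moreover have "real (96 * (m + 2) ^ 3) = 96 * (real m + 2) ^ 3" by (simp add: add.commute)
    moreover have "(15 * real m) ^ 3 = 3375 * real m ^ 3" by (simp add: power_mult_distrib)
    moreover have "0 \<le> real m ^ 3" by simp
    ultimately show ?thesis by linarith
  qed
  finally have "real k powr (1 / 3) \<le> ((15 * real m) ^ 3) powr (1 / 3)" by (intro powr_mono2) auto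
  also have "\<dots> = 15 * real m"
  proof -
    have "(x ^ 3) powr (1 / 3) = x" if "x > 0" for x :: real
      using that by (simp add: powr_powr flip: powr_numeral)
    from this[of "15 * real m"] show ?thesis using m1 by linarith
  qed
  finally have "ln 2 / 15 * real k powr (1 / 3) \<le> ln 2 / 15 * (15 * real m)"
    by (intro mult_left_mono) auto
  also have "\<dots> = ln (2 ^ m)" by (simp add: ln_realpow)
  also have "\<dots> \<le> ln (real (max_moves k))"
  proof -
    have "2 ^ m \<le> real (max_moves k)"
      using max_moves_ge[OF m] by (metis of_nat_le_iff of_nat_numeral of_nat_power)
    then show ?thesis by (subst ln_le_cancel_iff) (auto intro: less_le_trans[of 0 "2 ^ m"])
  qed
  finally show "ln 2 / 15 * real k powr (1 / 3) \<le> ln (real (max_moves k))" .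
qed

end
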